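(* Let $(\mathcal{A},\varphi)$ be a $W^*$-probability space, let $H=L^2(\mathcal{A},\varphi)$ be its GNS Hilbert space with cyclic vector $\Omega$ (so that $\varphi(a)=\langle a\Omega,\Omega\rangle_H$), and regard $\mathcal{A}$ as a subalgebra of $B(H)$. Let $p:H\to H$ be the orthogonal projection onto $\mathbb{C}\Omega$ and $q=\mathrm{id}_H-p$. Then the multivariate inverse Markov--Krein transform of $\varphi$ equals the linear form $[\varphi]$: for all $n\ge 1$ and all $a_1,\ldots,a_n\in\mathcal{A}$, $$\mathrm{Tr}_H\Big[a_1\cdots a_n-(q a_1 q)(q a_2 q)\cdots(q a_n q)\Big]=[\varphi](a_1,\ldots,a_n).$$ (The operator inside the trace has finite rank, so the trace is well defined.)
   Context: A $W^*$-probability space is a von Neumann algebra $\mathcal{A}$ with a faithful normal state $\varphi$. The Boolean cumulants $\beta^\varphi(a_1,\ldots,a_n)$ of $\varphi$ are the multilinear functionals determined recursively by $\varphi(a_1\cdots a_n)=\sum_{I}\prod_{\{i,i+1,\ldots,j\}\in I}\beta^\varphi(a_i,a_{i+1},\ldots,a_j)$, where $I$ ranges over all interval partitions of $\{1,\ldots,n\}$ (partitions all of whose blocks are intervals of consecutive integers). The linear functional $[\varphi]$ on the tensor algebra $T(\mathcal{A})=\mathbb{C}1\oplus\bigoplus_{n\ge1}\mathcal{A}^{\otimes n}$ is defined by $[\varphi](1)=1$ and $$[\varphi](a_1,\ldots,a_n)=[\varphi](a_1\otimes\cdots\otimes a_n)=\sum_{\ell=1}^n\ \sum_{1\le i_1<\cdots<i_\ell\le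 n}\ \prod_{k=1}^{\ell}\beta^\varphi(a_{i_k},a_{i_k+1},\ldots,a_{i_{k+1}-1}),$$ with the cyclic conventions $i_{\ell+1}=i_1$ and indices read cyclically modulo $n$: the last factor ($k=\ell$) is $\beta^\varphi(a_{i_\ell},\ldots,a_n,a_1,\ldots,a_{i_1-1})$; in particular for $\ell=1$ the factor is $\beta^\varphi(a_{i_1},\ldots,a_n,a_1,\ldots,a_{i_1-1})$, with all $n$ arguments. *)

theory Defs
  imports "HOL-Analysis.Analysis" "HOL-Library.Disjoint_Sets"
begin

section \<open>Complex Hilbert spaces\<close>

text \<open>
  The real structure (topology, norm, real inner product) is the one underlying the complex one:
  the real inner product is the real part of the complex inner product, which is linear in the
  first and conjugate-linear in the second argument.
\<close>

class complex_hilbert_space = real_inner + complete_space +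
  fixes scaleC :: "complex \<Rightarrow> 'a \<Rightarrow> 'a"  (infixr "*\<^sub>C" 75)
    and cinner :: "'a \<Rightarrow> 'a \<Rightarrow> complex"
  assumes scaleC_add_right: "c *\<^sub>C (x + y) = c *\<^sub>C x + c *\<^sub>C y"
    and scaleC_add_left: "(c + d) *\<^sub>C x = c *\<^sub>C x + d *\<^sub>C x"
    and scaleC_scaleC: "c *\<^sub>C (d *\<^sub>C x) = (c * d) *\<^sub>C x"
    and scaleR_eq_scaleC: "r *\<^sub>R x = complex_of_real r *\<^sub>C x"
    and cinner_commute: "cinner x y = cnj (cinner y x)"
    and cinner_add_left: "cinner (x + y) z = cinner x z + cinner y z"
    and cinner_scaleC_left: "cinner (c *\<^sub>C x) y = c * cinner x y"
    and inner_eq_Re_cinner: "inner x y = Re (cinner x y)"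

instantiation complex :: complex_hilbert_space
begin

definition scaleC_complex :: "complex \<Rightarrow> complex \<Rightarrow> complex"
  where "scaleC_complex c x = c * x"

definition cinner_complex :: "complex \<Rightarrow> complex \<Rightarrow> complex"
  where "cinner_complex x y = x * cnj y"

instance
  by standard (auto simp: scaleC_complex_def cinner_complex_def algebra_simps scaleR_conv_of_real
      inner_complex_def)

end

global_interpretation cvec: vector_space "scaleC :: complex \<Rightarrow> 'a \<Rightarrow> 'a::complex_hilbert_space"
  defines cspan = cvec.span
proof
  show "1 *\<^sub>C x = x" for x :: 'a
    using scaleR_eq_scaleC[of 1 x] by simp
qed (simp_all add: scaleC_add_left scaleC_add_right scaleC_scaleC)

definition bounded_clinear ::
  "('a::complex_hilbert_space \<Rightarrow> 'b::complex_hilbert_space) \<Rightarrow> bool"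
  where "bounded_clinear f \<longleftrightarrow> bounded_linear f \<and> (\<forall>c x. f (c *\<^sub>C x) = c *\<^sub>C f x)"

text \<open>\<open>is_adjoint b a\<close> says that \<open>b = a\<^sup>*\<close>.\<close>

definition is_adjoint ::
  "('a::complex_hilbert_space \<Rightarrow> 'a) \<Rightarrow> ('a \<Rightarrow> 'a) \<Rightarrow> bool"
  where "is_adjoint b a \<longleftrightarrow> (\<forall>x y. cinner (a x) y = cinner x (b y))"

definition self_adjoint :: "('a::complex_hilbert_space \<Rightarrow> 'a) \<Rightarrow> bool"
  where "self_adjoint a \<longleftrightarrow> is_adjoint a a"

definition op_le :: "('a::complex_hilbert_space \<Rightarrow> 'a) \<Rightarrow> ('a \<Rightarrow> 'a) \<Rightarrow> bool"
  where "op_le a b \<longleftrightarrow> (\<forall>x. cinner (b x - a x) x \<in> \<real>\<^sub>\<ge>\<^sub>0)"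

definition op_prod :: "('a \<Rightarrow> 'a) list \<Rightarrow> 'a \<Rightarrow> 'a"
  where "op_prod as = foldr (\<circ>) as id"

definition orth_proj :: "'a::complex_hilbert_space set \<Rightarrow> 'a \<Rightarrow> 'a"
  where "orth_proj M x = (THE y. y \<in> M \<and> (\<forall>z\<in>M. cinner (x - y) z = 0))"

definition finite_rank :: "('a::complex_hilbert_space \<Rightarrow> 'a) \<Rightarrow> bool"
  where "finite_rank T \<longleftrightarrow> bounded_clinear T \<and> (\<exists>S. finite S \<and> range T \<subseteq> cspan S)"

definition orthonormal_basis :: "'a::complex_hilbert_space set \<Rightarrow> bool"
  where "orthonormal_basis E \<longleftrightarrow>
    (\<forall>e\<in>E. \<forall>f\<in>E. cinner e f = (if e = f then 1 else 0)) \<and> closure (cspan E) = UNIV"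

text \<open>
  The trace in terms of orthonormal bases of arbitrary cardinality. The sums are unconditional and
  required to have the same value for all bases; the value of \<open>op_trace\<close> is meaningful for
  trace class operators, in particular for finite rank ones.
\<close>

definition has_trace :: "('a::complex_hilbert_space \<Rightarrow> 'a) \<Rightarrow> complex \<Rightarrow> bool"
  where "has_trace T t \<longleftrightarrow>
    (\<forall>E. orthonormal_basis E \<longrightarrow> ((\<lambda>e. cinner (T e) e) has_sum t) E)"

definition op_trace :: "('a::complex_hilbert_space \<Rightarrow> 'a) \<Rightarrow> complex"
  where "op_trace T = (THE t. has_trace T t)"


section \<open>\<open>W\<^sup>*\<close>-probability spaces and the GNS representation\<close>

definition commutant ::
  "('a::complex_hilbert_space \<Rightarrow> 'a) set \<Rightarrow> ('a \<Rightarrow> 'a) set"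
  where "commutant A = {b. bounded_clinear b \<and> (\<forall>a\<in>A. a \<circ> b = b \<circ> a)}"

text \<open>
  A self-adjoint set of bounded operators that equals its double commutant; it is then
  automatically a unital subalgebra.
\<close>

locale von_neumann_algebra =
  fixes A :: "('k::complex_hilbert_space \<Rightarrow> 'k) set"
  assumes bounded: "a \<in> A \<Longrightarrow> bounded_clinear a"
    and adjoint_closed: "a \<in> A \<Longrightarrow> \<exists>b\<in>A. is_adjoint b a"
    and double_commutant: "commutant (commutant A) = A"

text \<open>
  The supremum of a set of self-adjoint elements, with respect to the operator order on the
  self-adjoint part of \<open>A\<close>.
\<close>

definition is_sup_in ::
  "('k::complex_hilbert_space \<Rightarrow> 'k) set \<Rightarrow> ('k \<Rightarrow> 'k) set \<Rightarrow> ('k \<Rightarrow> 'k) \<Rightarrow> bool"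
  where "is_sup_in A D s \<longleftrightarrow> s \<in> A \<and> self_adjoint s \<and> (\<forall>a\<in>D. op_le a s) \<and>
    (\<forall>t\<in>A. self_adjoint t \<and> (\<forall>a\<in>D. op_le a t) \<longrightarrow> op_le s t)"

text \<open>
  Normality is preservation of suprema of upward directed sets of self-adjoint elements. The values
  of \<open>\<phi>\<close> outside of \<open>A\<close> are irrelevant.
\<close>

locale wstar_probability_space = von_neumann_algebra A
  for A :: "('k::complex_hilbert_space \<Rightarrow> 'k) set" +
  fixes \<phi> :: "('k \<Rightarrow> 'k) \<Rightarrow> complex"
  assumes add: "\<lbrakk>a \<in> A; b \<in> A\<rbrakk> \<Longrightarrow> \<phi> (\<lambda>x. a x + b x) = \<phi> a + \<phi> b"
    and scale: "a \<in> A \<Longrightarrow> \<phi> (\<lambda>x. c *\<^sub>C a x) = c * \<phi> a"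
    and unit: "\<phi> id = 1"
    and positive: "\<lbrakk>a \<in> A; b \<in> A; is_adjoint b a\<rbrakk> \<Longrightarrow> \<phi> (b \<circ> a) \<in> \<real>\<^sub>\<ge>\<^sub>0"
    and faithful: "\<lbrakk>a \<in> A; b \<in> A; is_adjoint b a; \<phi> (b \<circ> a) = 0\<rbrakk> \<Longrightarrow> a = (\<lambda>x. 0)"
    and normal: "\<lbrakk>D \<noteq> {}; D \<subseteq> A; \<And>a. a \<in> D \<Longrightarrow> self_adjoint a;
        \<And>a b. \<lbrakk>a \<in> D; b \<in> D\<rbrakk> \<Longrightarrow> \<exists>c\<in>D. op_le a c \<and> op_le b c; is_sup_in A D s\<rbrakk>
      \<Longrightarrow> Re (\<phi> s) = (SUP a\<in>D. Re (\<phi> a))"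

text \<open>
  The GNS space \<open>L\<^sup>2(A, \<phi>)\<close> with its left action \<open>\<pi>\<close> of \<open>A\<close> and its cyclic vector \<open>\<Omega>\<close>,
  which are determined by these properties up to a unitary intertwiner.
\<close>

locale gns_representation =
  fixes A :: "('k::complex_hilbert_space \<Rightarrow> 'k) set"
    and \<phi> :: "('k \<Rightarrow> 'k) \<Rightarrow> complex"
    and \<pi> :: "('k \<Rightarrow> 'k) \<Rightarrow> ('h::complex_hilbert_space \<Rightarrow> 'h)"
    and \<Omega> :: 'h
  assumes rep_bounded: "a \<in> A \<Longrightarrow> bounded_clinear (\<pi> a)"
    and rep_add: "\<lbrakk>a \<in> A; b \<in> A\<rbrakk> \<Longrightarrow> \<pi> (\<lambda>x. a x + b x) = (\<lambda>x. \<pi> a x + \<pi> b x)"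
    and rep_scale: "a \<in> A \<Longrightarrow> \<pi> (\<lambda>x. c *\<^sub>C a x) = (\<lambda>x. c *\<^sub>C \<pi> a x)"
    and rep_mult: "\<lbrakk>a \<in> A; b \<in> A\<rbrakk> \<Longrightarrow> \<pi> (a \<circ> b) = \<pi> a \<circ> \<pi> b"
    and rep_unit: "\<pi> id = id"
    and rep_adjoint: "\<lbrakk>a \<in> A; b \<in> A; is_adjoint b a\<rbrakk> \<Longrightarrow> is_adjoint (\<pi> b) (\<pi> a)"
    and cyclic: "closure ((\<lambda>a. \<pi> a \<Omega>) ` A) = UNIV"
    and vector_state: "a \<in> A \<Longrightarrow> \<phi> a = cinner (\<pi> a \<Omega>) \<Omega>"


section \<open>Boolean cumulants and the linear form \<open>[\<phi>]\<close>\<close>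

text \<open>Positions in a word of length \<open>n\<close> are counted from \<open>0\<close>.\<close>

definition interval_partitions :: "nat \<Rightarrow> nat set set set"
  where "interval_partitions n =
    {P. partition_on {0..<n} P \<and> (\<forall>B\<in>P. \<exists>i j. B = {i..<j})}"

lemma finite_interval_partitions: "finite (interval_partitions n)"
proof (rule finite_subset)
  show "interval_partitions n \<subseteq> Pow (Pow {0..<n})"
    unfolding interval_partitions_def partition_on_def by auto
qed simp

lemma whole_in_interval_partitions: "n > 0 \<Longrightarrow> {{0..<n}} \<in> interval_partitions n"
  unfolding interval_partitions_def partition_on_def by (auto simp: disjoint_def)

lemma interval_partitions_block_less:
  assumes "P \<in> interval_partitions (length as) - {{{0..<length as}}}" and "B \<in> P"
  shows "length (nths as B) < length as"
proof -
  have P: "partition_on {0..<length as} P" and ne: "P \<noteq> {{0..<length as}}"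
    using assms(1) by (auto simp: interval_partitions_def)
  have sub: "B \<subseteq> {0..<length as}"
    using P assms(2) unfolding partition_on_def by auto
  have "B \<noteq> {0..<length as}"
  proof
    assume eq: "B = {0..<length as}"
    have "C = B" if "C \<in> P" for C
    proof (rule ccontr)
      assume "C \<noteq> B"
      then have "C \<inter> B = {}"
        using P that assms(2) unfolding partition_on_def disjoint_def by auto
      moreover have "C \<subseteq> B" "C \<noteq> {}"
        using P that eq unfolding partition_on_def by auto
      ultimately show False by auto
    qed
    then have "P = {B}" using assms(2) by blast
    then have "P = {{0..<length as}}" by (simp only: eq)
    with ne show False by contradiction
  qed
  with sub have "B \<subset> {0..<length as}" by (simp only: psubset_eq simp_thms)
  then have "card B < length as"
    using psubset_card_mono[of "{0..<length as}" B] by simp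
  moreover have "{i. i < length as \<and> i \<in> B} = B" using sub by auto
  ultimately show ?thesis by (simp add: length_nths)
qed

text \<open>
  The moment-cumulant formula (\<open>boolean_moment_cumulant\<close> below), solved for the term of the one-block
  partition.
\<close>

function boolean_cumulant ::
  "(('k \<Rightarrow> 'k) \<Rightarrow> complex) \<Rightarrow> ('k \<Rightarrow> 'k) list \<Rightarrow> complex"
  where "boolean_cumulant \<phi> as = \<phi> (op_prod as) -
    (\<Sum>P \<in> interval_partitions (length as) - {{{0..<length as}}}.
       \<Prod>B\<in>P. boolean_cumulant \<phi> (nths as B))"
  by pat_completeness auto
termination
proof (relation "Wellfounded.measure (\<lambda>(\<phi>, as). length as)")
  fix \<phi> :: "('k \<Rightarrow> 'k) \<Rightarrow> complex" and as :: "('k \<Rightarrow> 'k) list" and P B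
  assume "P \<in> interval_partitions (length as) - {{{0..<length as}}}" "B \<in> P"
  then show "((\<phi>, nths as B), \<phi>, as) \<in> Wellfounded.measure (\<lambda>(\<phi>, as). length as)"
    by (simp only: in_measure prod.case interval_partitions_block_less)
qed (rule wf_measure)

declare boolean_cumulant.simps [simp del]

lemma boolean_moment_cumulant:
  assumes "as \<noteq> []"
  shows "\<phi> (op_prod as) =
    (\<Sum>P \<in> interval_partitions (length as). \<Prod>B\<in>P. boolean_cumulant \<phi> (nths as B))"
proof -
  have "nths as {0..<length as} = as"
    by (simp add: nths_all)
  moreover have "{{0..<length as}} \<in> interval_partitions (length as)"
    using assms by (intro whole_in_interval_partitions) simp
  ultimately show ?thesis
    by (simp add: sum.remove[OF finite_interval_partitions] boolean_cumulant.simps[of \<phi> as])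
qed

text \<open>
  The cyclic segment of a word from position \<open>i\<close> (inclusive) to position \<open>j\<close> (exclusive); the
  segment from \<open>i\<close> to \<open>i\<close> is the whole word, read cyclically from \<open>i\<close>.
\<close>

definition cyclic_segment :: "'a list \<Rightarrow> nat \<Rightarrow> nat \<Rightarrow> 'a list"
  where "cyclic_segment as i j =
    (if i < j then take (j - i) (drop i as) else drop i as @ take j as)"

text \<open>
  The value of \<open>[\<phi>]\<close> on the elementary tensor with the entries of \<open>as\<close>. The lists \<open>is\<close> are the
  increasing sequences of cut positions.
\<close>

definition cyclic_form ::
  "(('k \<Rightarrow> 'k) \<Rightarrow> complex) \<Rightarrow> ('k \<Rightarrow> 'k) list \<Rightarrow> complex"
  where "cyclic_form \<phi> as = (if as = [] then 1 else
    (\<Sum>l = 1..length as.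
       \<Sum>is \<in> {is. length is = l \<and> sorted_wrt (<) is \<and> set is \<subseteq> {0..<length as}}.
         \<Prod>k<l. boolean_cumulant \<phi> (cyclic_segment as (is ! k) (is ! (Suc k mod l)))))"

end

theory Submission
  imports Defs
begin

text \<open>
  Let \<open>p\<close> be the projection onto the line of \<open>\<Omega>\<close> and \<open>q = 1 - p\<close>. Writing \<open>1 = p + q\<close> between
  the factors of \<open>\<langle>a\<^sub>1 \<cdots> a\<^sub>n \<Omega>, \<Omega>\<rangle>\<close> and splitting at the first \<open>p\<close> gives the recursion of the
  Boolean moment-cumulant formula by the first block, so that
  \<open>\<beta>(a\<^sub>1, \<dots>, a\<^sub>n) = \<langle>a\<^sub>1 q a\<^sub>2 q \<cdots> q a\<^sub>n \<Omega>, \<Omega>\<rangle>\<close>. The same splitting of \<open>a\<^sub>1 \<cdots> a\<^sub>n\<close> turns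
  \<open>a\<^sub>1 \<cdots> a\<^sub>n - q a\<^sub>1 q \<cdots> q a\<^sub>n q\<close> into a sum of operators of rank one, whose trace is
  \<open>\<Sum>\<^sub>m \<langle>a\<^sub>m\<^sub>+\<^sub>1 \<cdots> a\<^sub>n q a\<^sub>1 q \<cdots> q a\<^sub>m \<Omega>, \<Omega>\<rangle>\<close>. Splitting once more between \<open>a\<^sub>m\<^sub>+\<^sub>1, \<dots>, a\<^sub>n\<close>, the
  summand \<open>m\<close> becomes the part of \<open>[\<phi>]\<close> whose first cut is in front of \<open>a\<^sub>m\<^sub>+\<^sub>1\<close>.
\<close>

section \<open>Orthonormal bases and the trace\<close>

lemma subspace_closure:
  fixes S :: "'a::real_normed_vector set"
  assumes "subspace S"
  shows "subspace (closure S)"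
proof (rule subspaceI)
  show "0 \<in> closure S"
    using subspace_0[OF assms] closure_subset by blast
  show "x + y \<in> closure S" if xy: "x \<in> closure S" "y \<in> closure S" for x y
  proof -
    obtain f g where "\<And>n. f n \<in> S" "f \<longlonglongrightarrow> x" "\<And>n. g n \<in> S" "g \<longlonglongrightarrow> y"
      using xy unfolding closure_sequential by metis
    then show ?thesis
      using assms unfolding closure_sequential
      by (intro exI[of _ "\<lambda>n. f n + g n"]) (auto intro: subspace_add tendsto_add)
  qed
  show "c *\<^sub>R x \<in> closure S" if x: "x \<in> closure S" for c x
  proof -
    obtain f where "\<And>n. f n \<in> S" "f \<longlonglongrightarrow> x"
      using x unfolding closure_sequential by metis
    then show ?thesis
      using assms unfolding closure_sequential
      by (intro exI[of _ "\<lambda>n. c *\<^sub>R f n"]) (auto intro: subspace_scale tendsto_scaleR)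
  qed
qed

text \<open>A sequence in \<open>S\<close> minimizing the distance to \<open>x\<close> is Cauchy by
  the parallelogram law, and its limit is a nearest point. A nonzero component of the residual along
  some \<open>z\<close> in \<open>S\<close> would allow a still smaller distance.\<close>

lemma closed_subspace_orthogonal_decomposition:
  fixes S :: "'a::{real_inner, complete_space} set"
  assumes S: "subspace S" "closed S"
  obtains y where "y \<in> S" "\<And>z. z \<in> S \<Longrightarrow> inner (x - y) z = 0"
proof -
  define d where "d = infdist x S"
  have ne: "S \<noteq> {}"
    using subspace_0[OF S(1)] by blast
  have d: "d \<le> norm (x - y)" if "y \<in> S" for y
    using infdist_le[OF that, of x] by (simp add: d_def dist_norm)
  have d0: "d \<ge> 0"
    by (simp add: d_def infdist_nonneg)
  have "\<exists>y\<in>S. (norm (x - y))\<^sup>2 < d\<^sup>2 + inverse (real (Suc n))" for n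
  proof (rule ccontr)
    assume contr: "\<not> ?thesis"
    have "sqrt (d\<^sup>2 + inverse (real (Suc n))) \<le> dist x y" if "y \<in> S" for y
      using contr that by (intro real_le_lsqrt) (auto simp: dist_norm not_less)
    then have "sqrt (d\<^sup>2 + inverse (real (Suc n))) \<le> d"
      unfolding d_def infdist_notempty[OF ne] by (intro cINF_greatest ne) simp
    then have "d\<^sup>2 + inverse (real (Suc n)) \<le> d\<^sup>2"
      by (rule sqrt_le_D)
    moreover have "inverse (real (Suc n)) > 0"
      by simp
    ultimately show False
      by linarith
  qed
  then obtain y where y: "\<And>n. y n \<in> S"
    and y_lt: "\<And>n. (norm (x - y n))\<^sup>2 < d\<^sup>2 + inverse (real (Suc n))"
    by metis
  have close: "(norm (y m - y n))\<^sup>2 \<le> 2 * inverse (real (Suc m)) + 2 * inverse (real (Suc n))" for m n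
  proof -
    have "(1 / 2) *\<^sub>R (y m + y n) \<in> S"
      using S(1) y by (simp add: subspace_add subspace_scale)
    then have "d\<^sup>2 \<le> (norm (x - (1 / 2) *\<^sub>R (y m + y n)))\<^sup>2"
      using d0 d by (intro power_mono) auto
    \<comment> \<open>Parallelogram law for \<open>x - y m\<close> and \<open>x - y n\<close>; the
      factor 4 appears because their sum is twice the difference of \<open>x\<close> and the
      midpoint.\<close>
    moreover have "(norm (y m - y n))\<^sup>2 + 4 * (norm (x - (1 / 2) *\<^sub>R (y m + y n)))\<^sup>2 =
        2 * (norm (x - y m))\<^sup>2 + 2 * (norm (x - y n))\<^sup>2"
      by (simp add: power2_norm_eq_inner inner_diff inner_add inner_commute algebra_simps)
    ultimately show ?thesis
      using y_lt[of m] y_lt[of n] by linarith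
  qed
  have "Cauchy y"
  proof (rule metric_CauchyI)
    fix e :: real assume e: "e > 0"
    then obtain N where N: "inverse (real (Suc N)) < e\<^sup>2 / 4"
      using reals_Archimedean[of "e\<^sup>2 / 4"] by auto
    have "dist (y m) (y n) < e" if "m \<ge> N" "n \<ge> N" for m n
    proof -
      have "inverse (real (Suc m)) \<le> inverse (real (Suc N))"
        "inverse (real (Suc n)) \<le> inverse (real (Suc N))"
        using that by (simp_all add: le_imp_inverse_le)
      then have "(norm (y m - y n))\<^sup>2 < e\<^sup>2"
        using close[of m n] N by linarith
      then show ?thesis
        using e by (simp add: dist_norm power_less_imp_less_base)
    qed
    then show "\<exists>M. \<forall>m\<ge>M. \<forall>n\<ge>M. dist (y m) (y n) < e"
      by blast
  qed
  then obtain l where l: "y \<longlonglongrightarrow> l"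
    by (auto simp: Cauchy_convergent_iff convergent_def)
  have "l \<in> S"
    using closed_sequentially[OF S(2) y l] .
  have "(\<lambda>n. (norm (x - y n))\<^sup>2) \<longlonglongrightarrow> (norm (x - l))\<^sup>2"
    by (intro tendsto_intros l)
  moreover have "(\<lambda>n. d\<^sup>2 + inverse (real (Suc n))) \<longlonglongrightarrow> d\<^sup>2"
    using tendsto_add[OF tendsto_const LIMSEQ_inverse_real_of_nat] by simp
  ultimately have le: "(norm (x - l))\<^sup>2 \<le> d\<^sup>2"
    by (rule LIMSEQ_le) (use y_lt in \<open>auto intro: less_imp_le\<close>)
  have expand: "(norm (w - t *\<^sub>R z))\<^sup>2 = (norm w)\<^sup>2 - 2 * t * inner w z + t\<^sup>2 * (norm z)\<^sup>2"
    for w z :: 'a and t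
    unfolding power2_norm_eq_inner
    by (simp add: inner_diff inner_commute power2_eq_square algebra_simps)
  have "inner (x - l) z = 0" if "z \<in> S" for z
  proof (cases "z = 0")
    case False
    \<comment> \<open>This \<open>t\<close> minimizes the quadratic polynomial of
      \<open>expand\<close>; it is the coefficient of the projection of \<open>x - l\<close> onto
      the line of \<open>z\<close>.\<close>
    define t where "t = inner (x - l) z / (norm z)\<^sup>2"
    have "l + t *\<^sub>R z \<in> S"
      using S(1) \<open>l \<in> S\<close> that by (simp add: subspace_add subspace_scale)
    then have "d\<^sup>2 \<le> (norm (x - (l + t *\<^sub>R z)))\<^sup>2"
      using d0 d by (intro power_mono) auto
    also have "x - (l + t *\<^sub>R z) = (x - l) - t *\<^sub>R z"
      by simp
    also have "(norm ((x - l) - t *\<^sub>R z))\<^sup>2 =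
        (norm (x - l))\<^sup>2 - 2 * t * inner (x - l) z + t\<^sup>2 * (norm z)\<^sup>2"
      by (rule expand)
    also have "\<dots> = (norm (x - l))\<^sup>2 - (inner (x - l) z)\<^sup>2 / (norm z)\<^sup>2"
      using False by (simp add: t_def field_simps power2_eq_square)
    finally have "(inner (x - l) z)\<^sup>2 / (norm z)\<^sup>2 \<le> 0"
      using le by linarith
    then have "(inner (x - l) z)\<^sup>2 \<le> 0"
      using False by (simp add: divide_le_0_iff)
    then show ?thesis
      by simp
  qed simp
  with \<open>l \<in> S\<close> show thesis
    by (rule that)
qed

section \<open>The complex inner product and its real part\<close>

lemma cinner_add_right: "cinner x (y + z) = cinner x y + cinner x z"
  by (metis cinner_add_left cinner_commute complex_cnj_add)

lemma cinner_scaleC_right: "cinner x (c *\<^sub>C y) = cnj c * cinner x y"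
  by (metis cinner_scaleC_left cinner_commute complex_cnj_mult)

lemma cinner_self: "cinner x x = complex_of_real ((norm x)\<^sup>2)"
proof -
  have "Im (cinner x x) = 0"
    using arg_cong[OF cinner_commute[of x x], of Im] by simp
  then show ?thesis
    by (simp add: complex_eq_iff power2_norm_eq_inner inner_eq_Re_cinner del: of_real_power)
qed

text \<open>Conjugate linearity turns the imaginary part of \<open>cinner x y\<close> into a real
  inner product with i times \<open>y\<close>. Boundedness and orthogonality can thus be transferred
  from the real inner product.\<close>

lemma cinner_eq_Complex: "cinner x y = Complex (inner x y) (inner x (\<i> *\<^sub>C y))"
  by (simp add: complex_eq_iff inner_eq_Re_cinner cinner_scaleC_right)

lemma norm_scaleC:
  fixes x :: "'a::complex_hilbert_space"
  shows "norm (c *\<^sub>C x) = norm c * norm x"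
proof -
  have "complex_of_real ((norm (c *\<^sub>C x))\<^sup>2) = complex_of_real ((norm c * norm x)\<^sup>2)"
    unfolding power_mult_distrib of_real_mult complex_norm_square
      cinner_self[of x, symmetric] cinner_self[of "c *\<^sub>C x", symmetric]
    by (simp add: cinner_scaleC_left cinner_scaleC_right mult_ac)
  then have "(norm (c *\<^sub>C x))\<^sup>2 = (norm c * norm x)\<^sup>2"
    by (simp only: of_real_eq_iff)
  then show ?thesis
    by simp
qed

lemma bounded_linear_cinner_left: "bounded_linear (\<lambda>x. cinner x y)"
  unfolding cinner_eq_Complex Complex_eq
  by (intro bounded_linear_add bounded_linear_inner_left bounded_linear_mult_const
      bounded_linear_const_mult bounded_linear_compose[OF bounded_linear_of_real])

lemma bounded_linear_scaleC_left: "bounded_linear (\<lambda>c. c *\<^sub>C (u::'a::complex_hilbert_space))"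
  by (rule bounded_linear_intro[of _ "norm u"])
    (simp_all add: scaleC_add_left scaleR_eq_scaleC scaleC_scaleC norm_scaleC scaleC_complex_def)

lemmas cinner_diff_left = linear_diff[OF bounded_linear.linear[OF bounded_linear_cinner_left]]
  and cinner_sum_left = linear_sum[OF bounded_linear.linear[OF bounded_linear_cinner_left]]
  and cinner_zero_left = linear_0[OF bounded_linear.linear[OF bounded_linear_cinner_left]]

lemma cinner_zero_right: "cinner x 0 = 0"
  using cinner_commute[of x 0] by (simp add: cinner_zero_left)

section \<open>Orthonormal bases: expansion and existence\<close>

lemma cinner_eq_0_cspan:
  assumes "\<And>e. e \<in> S \<Longrightarrow> cinner w e = 0" and "z \<in> cspan S"
  shows "cinner w z = 0"
  using assms(2)
  by (induction rule: cvec.span_induct_alt)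
    (simp_all add: assms(1) cinner_zero_right cinner_add_right cinner_scaleC_right)

text \<open>By density some finite combination \<open>y\<close> of elements of \<open>E\<close> is
  close to \<open>x\<close>. For every finite \<open>G\<close> containing its support, the partial
  sum over \<open>G\<close> is the orthogonal projection of \<open>x\<close> onto
  \<open>cspan G\<close>, hence at least as close to \<open>x\<close> as \<open>y\<close>
  is.\<close>

lemma orthonormal_basis_has_sum:
  assumes "orthonormal_basis E"
  shows "((\<lambda>e. cinner x e *\<^sub>C e) has_sum x) E"
  unfolding has_sum_def
proof (rule tendstoI)
  fix \<epsilon> :: real assume "\<epsilon> > 0"
  have on: "cinner e f = (if e = f then 1 else 0)" if "e \<in> E" "f \<in> E" for e f
    using assms that by (auto simp: orthonormal_basis_def)
  have "x \<in> closure (cspan E)"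
    using assms by (simp add: orthonormal_basis_def)
  then obtain y where y: "y \<in> cspan E" "dist y x < \<epsilon>"
    using \<open>\<epsilon> > 0\<close> by (auto simp: closure_approachable)
  then obtain F r where F: "finite F" "F \<subseteq> E" and y_eq: "y = (\<Sum>e\<in>F. r e *\<^sub>C e)"
    by (auto simp: cvec.span_explicit)
  show "\<forall>\<^sub>F G in finite_subsets_at_top E. dist (\<Sum>e\<in>G. cinner x e *\<^sub>C e) x < \<epsilon>"
    unfolding eventually_finite_subsets_at_top
  proof (intro exI conjI allI impI)
    fix G assume G: "finite G \<and> F \<subseteq> G \<and> G \<subseteq> E"
    define s where "s = (\<Sum>e\<in>G. cinner x e *\<^sub>C e)"
    have "cinner s f = cinner x f" if "f \<in> G" for f
    proof -
      have "cinner s f = (\<Sum>e\<in>G. if e = f then cinner x f else 0)"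
        unfolding s_def cinner_sum_left
        using G that by (intro sum.cong refl) (auto simp: cinner_scaleC_left on subset_eq)
      with G that show ?thesis
        by simp
    qed
    moreover have "y \<in> cspan G" "s \<in> cspan G"
      using G unfolding y_eq s_def
      by (auto intro!: cvec.span_sum cvec.span_scale intro: cvec.span_base)
    then have "s - y \<in> cspan G"
      by (intro cvec.span_diff)
    ultimately have "cinner (x - s) (s - y) = 0"
      by - (rule cinner_eq_0_cspan[of G], auto simp: cinner_diff_left)
    then have "orthogonal (x - s) (s - y)"
      by (simp add: orthogonal_def inner_eq_Re_cinner)
    then have "(norm (x - y))\<^sup>2 = (norm (x - s))\<^sup>2 + (norm (s - y))\<^sup>2"
      using norm_add_Pythagorean[of "x - s" "s - y"] by simp
    then have "(norm (x - s))\<^sup>2 \<le> (norm (x - y))\<^sup>2"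
      by simp
    then have "dist s x \<le> dist y x"
      by (simp add: dist_norm norm_minus_commute abs_le_square_iff[symmetric])
    with y show "dist (\<Sum>e\<in>G. cinner x e *\<^sub>C e) x < \<epsilon>"
      by (simp add: s_def)
  qed (use F in auto)
qed

text \<open>Zorn gives a maximal orthonormal set; a vector outside its closed span would leave a
  nonzero residual orthogonal to the set, which could be normalized and added. Existence is what
  makes the trace unique: without any basis, \<open>has_trace\<close> would hold vacuously for every
  value.\<close>

lemma orthonormal_basis_exists:
  obtains E :: "'a::complex_hilbert_space set" where "orthonormal_basis E"
proof -
  define \<O> where "\<O> = {E :: 'a set. \<forall>e\<in>E. \<forall>f\<in>E. cinner e f = (if e = f then 1 else 0)}"
  have "\<exists>E\<in>\<O>. \<forall>X\<in>\<O>. E \<subseteq> X \<longrightarrow> X = E"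
  proof (rule subset_Zorn')
    fix C assume C: "subset.chain \<O> C"
    have "cinner e f = (if e = f then 1 else 0)" if "X \<in> C" "Y \<in> C" "e \<in> X" "f \<in> Y" for X Y e f
    proof -
      have "X \<subseteq> Y \<or> Y \<subseteq> X" "X \<in> \<O>" "Y \<in> \<O>"
        using C that by (auto simp: subset.chain_def)
      with that show ?thesis
        unfolding \<O>_def by blast
    qed
    then show "\<Union>C \<in> \<O>"
      by (auto simp: \<O>_def)
  qed
  then obtain E where E: "E \<in> \<O>" and maximal: "\<And>X. \<lbrakk>X \<in> \<O>; E \<subseteq> X\<rbrakk> \<Longrightarrow> X = E"
    by blast
  let ?M = "closure (cspan E)"
  have "subspace (cspan E)"
    by (rule subspaceI)
      (auto simp: scaleR_eq_scaleC intro: cvec.span_zero cvec.span_add cvec.span_scale)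
  then have "subspace ?M"
    by (rule subspace_closure)
  have "x \<in> ?M" for x
  proof (rule ccontr)
    assume "x \<notin> ?M"
    obtain y where y: "y \<in> ?M" "\<And>z. z \<in> ?M \<Longrightarrow> inner (x - y) z = 0"
      using closed_subspace_orthogonal_decomposition[OF \<open>subspace ?M\<close> closed_closure, of x] by blast
    define w where "w = x - y"
    have "w \<noteq> 0"
      using \<open>x \<notin> ?M\<close> y by (auto simp: w_def)
    have orth: "cinner w e = 0" if "e \<in> E" for e
    proof -
      \<comment> \<open>The decomposition is orthogonal for the real inner product only; testing
        with both \<open>e\<close> and i times \<open>e\<close> gives complex orthogonality.\<close>
      have "e \<in> ?M" "\<i> *\<^sub>C e \<in> ?M"
        using that closure_subset by (auto intro!: subsetD[OF closure_subset] cvec.span_scale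
            intro: cvec.span_base)
      then show ?thesis
        using y by (simp add: cinner_eq_Complex w_def complex_eq_iff)
    qed
    define u where "u = complex_of_real (inverse (norm w)) *\<^sub>C w"
    have u_E: "cinner u e = 0" "cinner e u = 0" if "e \<in> E" for e
      using orth[OF that] cinner_commute[of e u] by (simp_all add: u_def cinner_scaleC_left)
    have "norm u = 1"
      using \<open>w \<noteq> 0\<close> by (simp add: u_def norm_scaleC del: of_real_inverse)
    then have u_u: "cinner u u = 1"
      by (simp add: cinner_self)
    have "insert u E \<in> \<O>"
      using E u_E u_u unfolding \<O>_def by auto
    then have "u \<in> E"
      using maximal by blast
    then show False
      using u_E u_u by force
  qed
  then have "orthonormal_basis E"
    using E by (auto simp: orthonormal_basis_def \<O>_def)
  then show thesis
    by (rule that)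
qed

section \<open>Sums of rank one operators and their traces\<close>

lemma op_trace_eq:
  fixes T :: "'a::complex_hilbert_space \<Rightarrow> 'a"
  assumes "has_trace T t"
  shows "op_trace T = t"
  unfolding op_trace_def
proof (rule the_equality, fact)
  fix s assume "has_trace T s"
  moreover obtain E :: "'a set" where "orthonormal_basis E"
    by (rule orthonormal_basis_exists)
  ultimately show "s = t"
    using assms has_sum_unique unfolding has_trace_def by blast
qed

text \<open>The diagonal entry of the summand \<open>k\<close> at \<open>e\<close> equals
  \<open>f k\<close> applied to the component of \<open>u k\<close> along \<open>e\<close>. As
  \<open>f k\<close> is bounded and linear, summing these over any basis gives
  \<open>f k (u k)\<close>.\<close>

lemma has_trace_sum_rank_one:
  fixes f :: "'i \<Rightarrow> 'a::complex_hilbert_space \<Rightarrow> complex"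
  assumes "\<And>k. k \<in> K \<Longrightarrow> bounded_clinear (f k)"
  shows "has_trace (\<lambda>x. \<Sum>k\<in>K. f k x *\<^sub>C u k) (\<Sum>k\<in>K. f k (u k))"
  unfolding has_trace_def
proof (intro allI impI)
  fix E :: "'a set" assume "orthonormal_basis E"
  have f: "bounded_linear (f k)" "f k (c *\<^sub>C x) = c * f k x" if "k \<in> K" for k c x
    using assms[OF that] by (simp_all add: bounded_clinear_def scaleC_complex_def)
  have "((\<lambda>e. \<Sum>k\<in>K. f k (cinner (u k) e *\<^sub>C e)) has_sum (\<Sum>k\<in>K. f k (u k))) E"
    using f(1)
  proof (induction K rule: infinite_finite_induct)
    case (insert k K)
    have "((\<lambda>e. f k (cinner (u k) e *\<^sub>C e)) has_sum f k (u k)) E"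
      by (rule has_sum_bounded_linear[OF insert.prems
            orthonormal_basis_has_sum[OF \<open>orthonormal_basis E\<close>]]) simp
    with insert show ?case
      by (simp add: has_sum_add)
  qed simp_all
  then show "((\<lambda>e. cinner (\<Sum>k\<in>K. f k e *\<^sub>C u k) e) has_sum (\<Sum>k\<in>K. f k (u k))) E"
    by (simp add: cinner_sum_left cinner_scaleC_left f(2) mult.commute cong: sum.cong)
qed

lemma finite_rank_sum_rank_one:
  fixes f :: "'i \<Rightarrow> 'a::complex_hilbert_space \<Rightarrow> complex"
  assumes "finite K" and "\<And>k. k \<in> K \<Longrightarrow> bounded_clinear (f k)"
  shows "finite_rank (\<lambda>x. \<Sum>k\<in>K. f k x *\<^sub>C u k)"
  unfolding finite_rank_def bounded_clinear_def
proof (intro conjI allI exI)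
  have f: "bounded_linear (f k)" "f k (c *\<^sub>C x) = c * f k x" if "k \<in> K" for k c x
    using assms(2)[OF that] by (simp_all add: bounded_clinear_def scaleC_complex_def)
  show "bounded_linear (\<lambda>x. \<Sum>k\<in>K. f k x *\<^sub>C u k)"
    by (intro bounded_linear_sum bounded_linear_compose[OF bounded_linear_scaleC_left] f)
  show "(\<Sum>k\<in>K. f k (c *\<^sub>C x) *\<^sub>C u k) = c *\<^sub>C (\<Sum>k\<in>K. f k x *\<^sub>C u k)" for c x
    by (simp add: f cvec.scale_sum_right scaleC_scaleC)
  show "finite (u ` K)"
    using assms(1) by simp
  show "range (\<lambda>x. \<Sum>k\<in>K. f k x *\<^sub>C u k) \<subseteq> cspan (u ` K)"
    by (auto intro!: cvec.span_sum cvec.span_scale intro: cvec.span_base)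
qed

section \<open>Interval partitions and cyclic cuts\<close>

text \<open>An interval partition is determined by the length \<open>k\<close> of the block
  containing 0 and by its other blocks, which, shifted down by \<open>k\<close>, form an arbitrary
  interval partition for \<open>n - k\<close>.\<close>

lemma bij_betw_interval_partitions:
  assumes "n > 0"
  shows "bij_betw (\<lambda>(k, Q). insert {0..<k} ((`) ((+) k) ` Q))
    (SIGMA k:{1..n}. interval_partitions (n - k)) (interval_partitions n)"
    (is "bij_betw ?f ?S _")
proof (rule bij_betw_imageI)
  have block0: "B = {0..<k}" if "k > 0" "B \<in> ?f (k, Q)" "0 \<in> B" for k Q B
    using that by auto
  have split: "k = k' \<and> Q = Q'"
    if k: "k > 0" "k' > 0" and eq: "?f (k, Q) = ?f (k', Q')" for k k' Q Q'
  proof -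
    have "{0..<k} \<in> ?f (k', Q')"
      using eq by auto
    then have "{0..<k} = {0..<k'}"
      by (rule block0[OF k(2)]) (use k in simp)
    then have kk: "k = k'"
      by (metis card_atLeastLessThan diff_zero)
    \<comment> \<open>The shifted blocks are recovered by deleting the first block, which is none of
      them because it contains 0.\<close>
    have rest: "(`) ((+) m) ` R = ?f (m, R) - {{0..<m}}" if "m > 0" for m R
    proof -
      have "{0..<m} \<notin> (`) ((+) m) ` R"
      proof
        assume "{0..<m} \<in> (`) ((+) m) ` R"
        then obtain C where C: "{0..<m} = (+) m ` C"
          by blast
        have "0 \<in> (+) m ` C"
          unfolding C[symmetric] using that by simp
        with that show False
          by auto
      qed
      then show ?thesis
        by auto
    qed
    have "(`) ((+) k) ` Q = ?f (k, Q) - {{0..<k}}"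
      by (rule rest[OF k(1)])
    also have "\<dots> = ?f (k, Q') - {{0..<k}}"
      using eq unfolding kk by (rule arg_cong)
    also have "\<dots> = (`) ((+) k) ` Q'"
      by (rule rest[OF k(1), symmetric])
    finally have "(`) ((+) k) ` Q = (`) ((+) k) ` Q'" .
    moreover have "inj ((`) ((+) k))"
      by (intro inj_on_image) simp
    ultimately have "Q = Q'"
      by (simp only: inj_image_eq_iff)
    with kk show ?thesis
      by simp
  qed
  show "inj_on ?f ?S"
  proof (rule inj_onI)
    fix x y assume xy: "x \<in> ?S" "y \<in> ?S" "?f x = ?f y"
    obtain k Q k' Q' where "x = (k, Q)" "y = (k', Q')"
      by (cases x, cases y)
    with xy split[of k k' Q Q'] show "x = y"
      by auto
  qed
  show "?f ` ?S = interval_partitions n"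
  proof (intro equalityI subsetI)
    fix P assume "P \<in> ?f ` ?S"
    then obtain k Q where k: "k \<ge> 1" "k \<le> n" and Q: "Q \<in> interval_partitions (n - k)"
      and P: "P = insert {0..<k} ((`) ((+) k) ` Q)"
      by auto
    have "partition_on ((+) k ` {0..<n - k}) ((`) ((+) k) ` Q - {{}})"
      using Q by (intro partition_on_inj_image) (auto simp: interval_partitions_def)
    moreover have "{} \<notin> Q"
      using Q by (auto simp: interval_partitions_def partition_on_def)
    then have "(`) ((+) k) ` Q - {{}} = (`) ((+) k) ` Q"
      by auto
    moreover have "(+) k ` {0..<n - k} = {k..<n}"
      using k by simp
    ultimately have part: "partition_on {k..<n} ((`) ((+) k) ` Q)"
      by simp
    have "partition_on {0..<n} P"
      unfolding P using part k
      by (subst partition_on_insert) (auto simp: disjnt_def partition_on_def)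
    moreover have "\<exists>i j. B = {i..<j}" if "B \<in> P" for B
    proof (cases "B = {0..<k}")
      case False
      then obtain C where "C \<in> Q" "B = (+) k ` C"
        using \<open>B \<in> P\<close> P by blast
      then obtain i j where "B = (+) k ` {i..<j}"
        using Q by (auto simp: interval_partitions_def)
      then have "B = {i + k..<j + k}"
        by simp
      then show ?thesis
        by blast
    qed blast
    ultimately show "P \<in> interval_partitions n"
      by (auto simp: interval_partitions_def)
  next
    fix P assume P: "P \<in> interval_partitions n"
    then have part: "partition_on {0..<n} P"
      by (auto simp: interval_partitions_def)
    then have "0 \<in> \<Union>P"
      using assms by (simp add: partition_on_def)
    then obtain B0 where B0: "B0 \<in> P" "0 \<in> B0"
      by blast
    then obtain i k where "B0 = {i..<k}"
      using P by (auto simp: interval_partitions_def)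
    with B0 have B0k: "B0 = {0..<k}" "k > 0"
      by auto
    have sub: "B0 \<subseteq> {0..<n}"
      using part B0 by (auto simp: partition_on_def)
    have kn: "k \<le> n"
      using sub B0k by simp
    have "P = insert {0..<k} (P - {{0..<k}})" and "disjnt {0..<k} (\<Union>(P - {{0..<k}}))"
      using B0 B0k part by (auto simp: partition_on_def disjoint_def disjnt_def)
    moreover have "{0..<n} - {0..<k} = {k..<n}"
      by auto
    ultimately have rest: "partition_on {k..<n} (P - {{0..<k}})"
      using part partition_on_insert[of "{0..<k}" "P - {{0..<k}}" "{0..<n}"] by simp
    \<comment> \<open>All blocks but the first lie in \<open>{k..<n}\<close>, where truncated
      subtraction of \<open>k\<close> inverts the shift.\<close>
    define Q where "Q = (`) (\<lambda>x. x - k) ` (P - {{0..<k}})"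
    have "partition_on ((\<lambda>x. x - k) ` {k..<n}) ((`) (\<lambda>x. x - k) ` (P - {{0..<k}}) - {{}})"
      by (intro partition_on_inj_image rest) (auto simp: inj_on_def)
    moreover have "(\<lambda>x. x - k) ` {k..<n} = {0..<n - k}"
      using kn unfolding image_minus_const_atLeastLessThan_nat by auto
    moreover have "{} \<notin> Q"
      using part by (auto simp: Q_def partition_on_def)
    ultimately have "partition_on {0..<n - k} Q"
      by (simp add: Q_def)
    moreover have shift: "(+) k ` (\<lambda>x. x - k) ` B = B" if "B \<in> P - {{0..<k}}" for B
    proof -
      have "B \<subseteq> {k..<n}"
        using rest that by (auto simp: partition_on_def)
      then show ?thesis
        by (force simp: image_image)
    qed
    have "\<exists>i j. C = {i..<j}" if C: "C \<in> Q" for C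
    proof -
      obtain B where B: "B \<in> P - {{0..<k}}" "C = (\<lambda>x. x - k) ` B"
        using C by (auto simp: Q_def)
      then obtain i j where ij: "B = {i..<j}"
        using P unfolding interval_partitions_def by blast
      have "B \<subseteq> {k..<n}" "B \<noteq> {}"
        using rest B by (auto simp: partition_on_def)
      then have "i \<ge> k" "i < j"
        using ij by (auto simp: subset_eq)
      then have "C = {i - k..<j - k}"
        unfolding B ij image_minus_const_atLeastLessThan_nat by auto
      then show ?thesis
        by blast
    qed
    ultimately have "Q \<in> interval_partitions (n - k)"
      by (auto simp: interval_partitions_def)
    moreover have "(`) ((+) k) ` Q = P - {{0..<k}}"
      unfolding Q_def image_image[of "(`) ((+) k)"]
      by (rule trans[OF image_cong[OF refl shift] image_ident])
    then have "P = ?f (k, Q)"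
      using B0 B0k by auto
    ultimately show "P \<in> ?f ` ?S"
      using B0k kn by (auto intro!: image_eqI[of _ _ "(k, Q)"])
  qed
qed

text \<open>Under the bijection above, the first block contributes \<open>g (take k as)\<close>, and
  a shifted block selects from \<open>as\<close> the letters that the unshifted block selects from
  \<open>drop k as\<close>.\<close>

lemma sum_interval_partitions_first_block:
  fixes g :: "'a list \<Rightarrow> 'b::comm_semiring_1"
  assumes "as \<noteq> []"
  shows "(\<Sum>P\<in>interval_partitions (length as). \<Prod>B\<in>P. g (nths as B)) =
    (\<Sum>k = 1..length as. g (take k as) *
      (\<Sum>P\<in>interval_partitions (length (drop k as)). \<Prod>B\<in>P. g (nths (drop k as) B)))"
proof -
  let ?n = "length as"
  have step: "(\<Prod>B\<in>insert {0..<k} ((`) ((+) k) ` Q). g (nths as B)) =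
      g (take k as) * (\<Prod>B\<in>Q. g (nths (drop k as) B))"
    if k: "1 \<le> k" and Q: "Q \<in> interval_partitions (?n - k)" for k Q
  proof -
    have fin: "finite Q"
      using Q by (auto simp: interval_partitions_def intro: finite_elements)
    have "0 \<notin> (+) k ` C" for C
      using k by auto
    moreover have "0 \<in> {0..<k}"
      using k by simp
    ultimately have "{0..<k} \<notin> (`) ((+) k) ` Q"
      by blast
    then have "(\<Prod>B\<in>insert {0..<k} ((`) ((+) k) ` Q). g (nths as B)) =
        g (nths as {0..<k}) * (\<Prod>B\<in>(`) ((+) k) ` Q. g (nths as B))"
      using fin by simp
    also have "(\<Prod>B\<in>(`) ((+) k) ` Q. g (nths as B)) = (\<Prod>B\<in>Q. g (nths (drop k as) B))"
      by (subst prod.reindex) (auto intro!: inj_on_subset[OF inj_on_image] simp: nths_drop)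
    also have "nths as {0..<k} = take k as"
      using nths_upt_eq_take[of as k] by (simp add: atLeast0LessThan)
    finally show ?thesis .
  qed
  have "(\<Sum>P\<in>interval_partitions ?n. \<Prod>B\<in>P. g (nths as B)) =
      (\<Sum>(k, Q)\<in>(SIGMA k:{1..?n}. interval_partitions (?n - k)).
        \<Prod>B\<in>insert {0..<k} ((`) ((+) k) ` Q). g (nths as B))"
    using sum.reindex_bij_betw[OF bij_betw_interval_partitions[of ?n],
        of "\<lambda>P. \<Prod>B\<in>P. g (nths as B)"] assms
    by (simp add: case_prod_unfold)
  also have "\<dots> = (\<Sum>k = 1..?n. \<Sum>Q\<in>interval_partitions (?n - k).
      \<Prod>B\<in>insert {0..<k} ((`) ((+) k) ` Q). g (nths as B))"
    by (rule sum.Sigma[symmetric]) (auto simp: finite_interval_partitions)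
  also have "\<dots> = (\<Sum>k = 1..?n. \<Sum>Q\<in>interval_partitions (?n - k).
      g (take k as) * (\<Prod>B\<in>Q. g (nths (drop k as) B)))"
    by (intro sum.cong refl step) auto
  finally show ?thesis
    by (simp add: sum_distrib_left)
qed

section \<open>Boolean cumulants from the recursion by the first block\<close>

lemma interval_partitions_0: "interval_partitions 0 = {{}}"
  by (auto simp: interval_partitions_def partition_on_empty)

text \<open>For \<open>k = length as\<close> the remaining word is empty. There the moment-cumulant
  formula holds because \<open>\<phi> id = 1\<close> and the only partition is empty, with product
  1.\<close>

lemma boolean_moment_cumulant_first_block:
  assumes unit: "\<phi> id = 1" and "as \<noteq> []"
  shows "\<phi> (op_prod as) =
    (\<Sum>k = 1..length as. boolean_cumulant \<phi> (take k as) * \<phi> (op_prod (drop k as)))"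
proof -
  have "(\<Sum>P\<in>interval_partitions (length bs). \<Prod>B\<in>P. boolean_cumulant \<phi> (nths bs B)) =
      \<phi> (op_prod bs)" for bs
  proof (cases "bs = []")
    case True
    then show ?thesis
      by (simp add: interval_partitions_0 unit op_prod_def)
  next
    case False
    then show ?thesis
      by (rule boolean_moment_cumulant[symmetric])
  qed
  then show ?thesis
    using sum_interval_partitions_first_block[OF \<open>as \<noteq> []\<close>, of "boolean_cumulant \<phi>"]
    by (simp only:)
qed

text \<open>The term \<open>k = length as\<close> is \<open>g as\<close> itself, since the empty
  product has \<open>\<phi>\<close>-value 1, and the other terms involve \<open>g\<close> only on
  shorter prefixes. The recursion therefore determines \<open>g\<close> by induction on the
  length.\<close>

lemma boolean_cumulant_unique:
  assumes unit: "\<phi> id = 1"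
    and rec: "\<And>bs. \<lbrakk>bs \<noteq> []; set bs \<subseteq> A\<rbrakk> \<Longrightarrow>
      \<phi> (op_prod bs) = (\<Sum>k = 1..length bs. g (take k bs) * \<phi> (op_prod (drop k bs)))"
    and "as \<noteq> []" "set as \<subseteq> A"
  shows "boolean_cumulant \<phi> as = g as"
  using assms(3,4)
proof (induction "length as" arbitrary: as rule: less_induct)
  case less
  let ?n = "length as"
  have split: "(\<Sum>k = 1..?n. f (take k as) * \<phi> (op_prod (drop k as))) =
      (\<Sum>k = 1..<?n. f (take k as) * \<phi> (op_prod (drop k as))) + f as"
    for f :: "('a \<Rightarrow> 'a) list \<Rightarrow> complex"
  proof -
    have "{1..?n} = insert ?n {1..<?n}"
      using less.prems(1) by (auto simp: Suc_le_eq)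
    then show ?thesis
      using unit by (simp add: op_prod_def add.commute)
  qed
  have "boolean_cumulant \<phi> (take k as) = g (take k as)" if "k \<in> {1..<?n}" for k
    using that less.prems set_take_subset[of k as] by (intro less.hyps) auto
  then have "(\<Sum>k = 1..<?n. boolean_cumulant \<phi> (take k as) * \<phi> (op_prod (drop k as))) =
      (\<Sum>k = 1..<?n. g (take k as) * \<phi> (op_prod (drop k as)))"
    by simp
  then show ?case
    using rec[OF less.prems] boolean_moment_cumulant_first_block[of \<phi>, OF unit less.prems(1)]
    unfolding split by simp
qed

section \<open>Cut sequences of a cyclic word\<close>

definition cuts_from :: "nat \<Rightarrow> nat \<Rightarrow> nat list set"
  where "cuts_from n i = {is. is \<noteq> [] \<and> hd is = i \<and> sorted_wrt (<) is \<and> set is \<subseteq> {0..<n}}"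

lemma finite_cuts: "finite {is. sorted_wrt (<) is \<and> set is \<subseteq> {0..<n::nat}}"
proof (rule finite_subset)
  show "{is. sorted_wrt (<) is \<and> set is \<subseteq> {0..<n}} \<subseteq> {is. set is \<subseteq> {0..<n} \<and> length is \<le> n}"
  proof safe
    fix js :: "nat list" assume "sorted_wrt (<) js" "set js \<subseteq> {0..<n}"
    then show "length js \<le> n"
      using card_mono[of "{0..<n}" "set js"] by (simp add: strict_sorted_iff distinct_card)
  qed
qed (simp add: finite_lists_length_le)

lemma finite_cuts_from: "finite (cuts_from n i)"
  by (rule finite_subset[OF _ finite_cuts[of n]]) (auto simp: cuts_from_def)

text \<open>Removing the first of several cuts leaves a sequence with a later first cut
  \<open>j\<close>. Conversely, \<open>i < j\<close> suffices for prepending \<open>i\<close>, as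
  \<open>j\<close> is the smallest of the remaining cuts.\<close>

lemma cuts_from_rec:
  assumes "i < n"
  shows "cuts_from n i = insert [i] (\<Union>j\<in>{i<..<n}. (#) i ` cuts_from n j)"
proof (intro equalityI subsetI)
  fix js assume js: "js \<in> cuts_from n i"
  then obtain ks where ks: "js = i # ks"
    by (cases js) (auto simp: cuts_from_def)
  show "js \<in> insert [i] (\<Union>j\<in>{i<..<n}. (#) i ` cuts_from n j)"
  proof (cases "ks = []")
    case False
    then have "hd ks \<in> set ks"
      by simp
    then have "ks \<in> cuts_from n (hd ks)" "hd ks \<in> {i<..<n}"
      using js ks False by (auto simp: cuts_from_def subset_eq)
    then show ?thesis
      using ks by blast
  qed (simp add: ks)
next
  fix js assume "js \<in> insert [i] (\<Union>j\<in>{i<..<n}. (#) i ` cuts_from n j)"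
  then consider "js = [i]" | j ks where "js = i # ks" "ks \<in> cuts_from n j" "i < j"
    by auto
  then show "js \<in> cuts_from n i"
  proof cases
    case 1
    then show ?thesis
      using assms by (simp add: cuts_from_def)
  next
    case 2
    then have "j \<le> x" if "x \<in> set ks" for x
      using that by (cases ks) (auto simp: cuts_from_def)
    with 2 assms show ?thesis
      by (force simp: cuts_from_def)
  qed
qed

text \<open>The product over the segments between the cuts of a cyclic word, the last segment running
  from the last cut over the end of the word to \<open>m\<close>.\<close>

fun cut_prod :: "('a list \<Rightarrow> complex) \<Rightarrow> 'a list \<Rightarrow> nat \<Rightarrow> nat list \<Rightarrow> complex"
  where "cut_prod g as m [] = 1"
  | "cut_prod g as m [i] = g (drop i as @ take m as)"
  | "cut_prod g as m (i # j # js) = g (take (j - i) (drop i as)) * cut_prod g as m (j # js)"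

text \<open>Appending \<open>m\<close> to the cuts encodes the passage over the end of the word.
  Since \<open>m <= hd js\<close>, the last cut and \<open>m\<close> fall into the wrap-around
  branch of \<open>cyclic_segment\<close>, also when they coincide and the segment is the whole
  word. Keeping \<open>m\<close> separate from \<open>hd js\<close> lets the induction remove
  cuts.\<close>

lemma cut_prod_eq_prod:
  assumes "js \<noteq> []" "sorted_wrt (<) js" "m \<le> hd js"
  shows "cut_prod g as m js =
    (\<Prod>k<length js. g (cyclic_segment as (js ! k) ((js @ [m]) ! Suc k)))"
  using assms
proof (induction js rule: induct_list012)
  case (3 i j js)
  have "m \<le> j"
    using 3 by simp
  moreover have "cyclic_segment as i j = take (j - i) (drop i as)"
    using 3 by (simp add: cyclic_segment_def)
  ultimately show ?case
    using 3 by (simp add: prod.lessThan_Suc_shift del: prod.lessThan_Suc)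
qed (auto simp: cyclic_segment_def)

text \<open>Grouping by the first cut \<open>m\<close> instead of the number of cuts fixes the end
  of the wrap-around segment, in parallel with the summands of the trace.\<close>

lemma cyclic_form_eq_sum_cuts:
  assumes "as \<noteq> []"
  shows "cyclic_form \<phi> as =
    (\<Sum>m<length as. \<Sum>js\<in>cuts_from (length as) m. cut_prod (boolean_cumulant \<phi>) as m js)"
proof -
  let ?n = "length as"
  let ?I = "\<lambda>l. {is. length is = l \<and> sorted_wrt (<) is \<and> set is \<subseteq> {0..<?n}}"
  let ?c = "boolean_cumulant \<phi>"
  have cyc: "(\<Prod>k<l. ?c (cyclic_segment as (js ! k) (js ! (Suc k mod l)))) =
      cut_prod ?c as (hd js) js" if "js \<in> ?I l" "1 \<le> l" for l js
  proof -
    have js: "js \<noteq> []" "length js = l" "sorted_wrt (<) js"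
      using that by auto
    \<comment> \<open>The index \<open>Suc k mod l\<close> is 0 only at the last cut, where the
      appended \<open>hd js\<close> takes its place.\<close>
    have "js ! (Suc k mod l) = (js @ [hd js]) ! Suc k" if "k < l" for k
      using that js by (cases "Suc k = l") (auto simp: nth_append hd_conv_nth)
    then show ?thesis
      using js by (subst cut_prod_eq_prod) auto
  qed
  have "cyclic_form \<phi> as = (\<Sum>l = 1..?n. \<Sum>js\<in>?I l. cut_prod ?c as (hd js) js)"
    unfolding cyclic_form_def if_not_P[OF assms] by (intro sum.cong refl cyc) auto
  also have "\<dots> = (\<Sum>js\<in>(\<Union>l\<in>{1..?n}. ?I l). cut_prod ?c as (hd js) js)"
    by (rule sum.UNION_disjoint[symmetric]) (auto intro: finite_subset[OF _ finite_cuts[of ?n]])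
  also have "(\<Union>l\<in>{1..?n}. ?I l) = (\<Union>m\<in>{..<?n}. cuts_from ?n m)"
  proof (intro equalityI subsetI)
    fix js assume "js \<in> (\<Union>m\<in>{..<?n}. cuts_from ?n m)"
    then have js: "js \<noteq> []" "sorted_wrt (<) js" "set js \<subseteq> {0..<?n}"
      by (auto simp: cuts_from_def)
    then have "length js \<le> ?n"
      using card_mono[of "{0..<?n}" "set js"] by (simp add: strict_sorted_iff distinct_card)
    then show "js \<in> (\<Union>l\<in>{1..?n}. ?I l)"
      using js by (cases js) auto
  next
    fix js assume "js \<in> (\<Union>l\<in>{1..?n}. ?I l)"
    then show "js \<in> (\<Union>m\<in>{..<?n}. cuts_from ?n m)"
      by (cases js) (auto simp: cuts_from_def)
  qed
  also have "(\<Sum>js\<in>(\<Union>m\<in>{..<?n}. cuts_from ?n m). cut_prod ?c as (hd js) js) =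
      (\<Sum>m<?n. \<Sum>js\<in>cuts_from ?n m. cut_prod ?c as (hd js) js)"
    by (rule sum.UNION_disjoint) (auto simp: finite_cuts_from, auto simp: cuts_from_def)
  also have "\<dots> = (\<Sum>m<?n. \<Sum>js\<in>cuts_from ?n m. cut_prod ?c as m js)"
    by (intro sum.cong refl) (auto simp: cuts_from_def)
  finally show ?thesis .
qed

text \<open>For fixed \<open>m\<close>, this is the recursion in \<open>i\<close> that
  \<open>cinner_op_prod_expand\<close> reproduces on the operator side.\<close>

lemma sum_cut_prod_rec:
  assumes "i < length as"
  shows "(\<Sum>js\<in>cuts_from (length as) i. cut_prod g as m js) =
    g (drop i as @ take m as) + (\<Sum>j\<in>{i<..<length as}. g (take (j - i) (drop i as)) *
      (\<Sum>js\<in>cuts_from (length as) j. cut_prod g as m js))"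
proof -
  let ?n = "length as"
  have "(\<Sum>js\<in>cuts_from ?n i. cut_prod g as m js) = cut_prod g as m [i] +
      (\<Sum>js\<in>(\<Union>j\<in>{i<..<?n}. (#) i ` cuts_from ?n j). cut_prod g as m js)"
    unfolding cuts_from_rec[OF assms]
    by (subst sum.insert) (auto simp: finite_cuts_from, auto simp: cuts_from_def)
  also have "(\<Sum>js\<in>(\<Union>j\<in>{i<..<?n}. (#) i ` cuts_from ?n j). cut_prod g as m js) =
      (\<Sum>j\<in>{i<..<?n}. \<Sum>js\<in>(#) i ` cuts_from ?n j. cut_prod g as m js)"
    by (rule sum.UNION_disjoint) (auto simp: finite_cuts_from, auto simp: cuts_from_def)
  also have "\<dots> = (\<Sum>j\<in>{i<..<?n}. \<Sum>js\<in>cuts_from ?n j.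
      g (take (j - i) (drop i as)) * cut_prod g as m js)"
  proof (rule sum.cong[OF refl])
    fix j assume "j \<in> {i<..<?n}"
    have "cut_prod g as m (i # js) = g (take (j - i) (drop i as)) * cut_prod g as m js"
      if "js \<in> cuts_from ?n j" for js
      using that by (cases js) (auto simp: cuts_from_def)
    then show "(\<Sum>js\<in>(#) i ` cuts_from ?n j. cut_prod g as m js) =
        (\<Sum>js\<in>cuts_from ?n j. g (take (j - i) (drop i as)) * cut_prod g as m js)"
      by (subst sum.reindex) auto
  qed
  finally show ?thesis
    by (simp add: sum_distrib_left)
qed

section \<open>Compression to the complement of a unit vector\<close>

lemma bounded_clinear_id: "bounded_clinear id"
  by (simp add: bounded_clinear_def bounded_linear_ident id_def)

lemma bounded_clinear_comp:
  "\<lbrakk>bounded_clinear f; bounded_clinear g\<rbrakk> \<Longrightarrow> bounded_clinear (f \<circ> g)"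
  by (auto simp: bounded_clinear_def o_def intro: bounded_linear_compose)

lemma bounded_clinear_op_prod:
  "(\<And>b. b \<in> set bs \<Longrightarrow> bounded_clinear b) \<Longrightarrow> bounded_clinear (op_prod bs)"
  by (induction bs) (auto simp: op_prod_def bounded_clinear_id intro: bounded_clinear_comp)

lemma bounded_clinear_cinner_left: "bounded_clinear (\<lambda>x. cinner x y)"
  by (simp add: bounded_clinear_def bounded_linear_cinner_left cinner_scaleC_left scaleC_complex_def)

lemma bounded_clinear_add: "bounded_clinear f \<Longrightarrow> f (x + y) = f x + f y"
  by (simp add: bounded_clinear_def bounded_linear.linear linear_add)

lemma bounded_clinear_diff: "bounded_clinear f \<Longrightarrow> f (x - y) = f x - f y"
  by (simp add: bounded_clinear_def bounded_linear.linear linear_diff)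

lemma bounded_clinear_sum: "bounded_clinear f \<Longrightarrow> f (\<Sum>i\<in>I. g i) = (\<Sum>i\<in>I. f (g i))"
  by (simp add: bounded_clinear_def bounded_linear.linear linear_sum)

lemma bounded_clinear_scaleC: "bounded_clinear f \<Longrightarrow> f (c *\<^sub>C x) = c *\<^sub>C f x"
  by (simp add: bounded_clinear_def)

lemma op_prod_Nil: "op_prod [] = id"
  by (simp add: op_prod_def)

lemma op_prod_Cons: "op_prod (b # bs) = b \<circ> op_prod bs"
  by (simp add: op_prod_def)

lemma op_prod_append: "op_prod (bs @ cs) = op_prod bs \<circ> op_prod cs"
  by (induction bs) (simp_all add: op_prod_Nil op_prod_Cons o_assoc)

section \<open>The projection onto a unit vector and compressed words\<close>

locale unit_vector =
  fixes \<Omega> :: "'h::complex_hilbert_space"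
  assumes cinner_unit: "cinner \<Omega> \<Omega> = 1"
begin

definition p :: "'h \<Rightarrow> 'h"
  where "p x = cinner x \<Omega> *\<^sub>C \<Omega>"

definition q :: "'h \<Rightarrow> 'h"
  where "q x = x - p x"

lemma orth_proj_eq_p: "orth_proj (cspan {\<Omega>}) = p"
proof
  fix x
  have *: "cinner (x - c *\<^sub>C \<Omega>) z = 0" if "c = cinner x \<Omega>" "z \<in> cspan {\<Omega>}" for c z
    using cinner_eq_0_cspan[of "{\<Omega>}" "x - c *\<^sub>C \<Omega>" z] that
    by (simp add: cinner_diff_left cinner_scaleC_left cinner_unit)
  show "orth_proj (cspan {\<Omega>}) x = p x"
    unfolding orth_proj_def
  proof (rule the_equality)
    show "p x \<in> cspan {\<Omega>} \<and> (\<forall>z\<in>cspan {\<Omega>}. cinner (x - p x) z = 0)"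
      using * by (auto simp: p_def intro: cvec.span_scale cvec.span_base)
  next
    fix y assume y: "y \<in> cspan {\<Omega>} \<and> (\<forall>z\<in>cspan {\<Omega>}. cinner (x - y) z = 0)"
    then obtain c where c: "y = c *\<^sub>C \<Omega>"
      by (auto simp: cvec.span_singleton)
    have "cinner (x - y) \<Omega> = 0"
      using y by (simp add: cvec.span_base)
    then show "y = p x"
      by (simp add: c p_def cinner_diff_left cinner_scaleC_left cinner_unit)
  qed
qed

lemma bounded_clinear_q: "bounded_clinear q"
  unfolding bounded_clinear_def q_def p_def
  by (auto intro!: bounded_linear_sub bounded_linear_ident bounded_linear_cinner_left
      bounded_linear_compose[OF bounded_linear_scaleC_left]
      simp: cinner_scaleC_left scaleC_scaleC cvec.scale_right_diff_distrib)

lemma cinner_q_unit: "cinner (q x) \<Omega> = 0"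
  by (simp add: q_def p_def cinner_diff_left cinner_scaleC_left cinner_unit)

lemma q_q: "q (q x) = q x"
  by (simp add: q_def[of "q x"] p_def cinner_q_unit)

text \<open>The word reads \<open>q b1 q b2 ... q bn\<close>, with no \<open>q\<close> at the right
  end: a trailing \<open>q\<close> would annihilate \<open>\<Omega>\<close>.\<close>

definition compressed :: "('h \<Rightarrow> 'h) list \<Rightarrow> 'h \<Rightarrow> 'h"
  where "compressed bs = op_prod (map ((\<circ>) q) bs)"

lemma compressed_Nil: "compressed [] = id"
  by (simp add: compressed_def op_prod_Nil)

lemma compressed_Cons: "compressed (b # bs) x = q (b (compressed bs x))"
  by (simp add: compressed_def op_prod_Cons)

lemma compressed_append: "compressed (bs @ cs) x = compressed bs (compressed cs x)"
  by (simp add: compressed_def op_prod_append)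

lemma bounded_clinear_compressed:
  "(\<And>b. b \<in> set bs \<Longrightarrow> bounded_clinear b) \<Longrightarrow> bounded_clinear (compressed bs)"
  unfolding compressed_def
  by (rule bounded_clinear_op_prod) (auto intro: bounded_clinear_comp bounded_clinear_q)

text \<open>Neighbouring copies of \<open>q\<close> merge by \<open>q_q\<close>, which leaves a
  single additional \<open>q\<close> at the right end.\<close>

lemma op_prod_compress:
  assumes "bs \<noteq> []"
  shows "op_prod (map (\<lambda>b. q \<circ> b \<circ> q) bs) x = compressed bs (q x)"
proof -
  \<comment> \<open>The extra \<open>q\<close> in front makes the claim true for the empty list, so
    that the induction can start there.\<close>
  have q: "q (op_prod (map (\<lambda>b. q \<circ> b \<circ> q) cs) x) = compressed cs (q x)" for cs
    by (induction cs) (simp_all add: op_prod_Nil op_prod_Cons compressed_Nil compressed_Cons q_q)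
  obtain c cs where "bs = c # cs"
    using assms by (cases bs) auto
  with q[of cs] show ?thesis
    by (simp add: op_prod_Cons compressed_Cons)
qed

text \<open>Writing \<open>1 = p + q\<close> in front of every factor, the summand \<open>k\<close> collects the words whose
  first \<open>p\<close> is in front of the factor \<open>k\<close>.\<close>

lemma op_prod_expand:
  assumes "\<And>b. b \<in> set bs \<Longrightarrow> bounded_clinear b"
  shows "op_prod bs x = compressed bs x +
    (\<Sum>k<length bs. cinner (op_prod (drop k bs) x) \<Omega> *\<^sub>C compressed (take k bs) \<Omega>)"
  using assms
proof (induction bs)
  case Nil
  then show ?case
    by (simp add: op_prod_Nil compressed_Nil)
next
  case (Cons b bs)
  have qb: "bounded_clinear (q \<circ> b)"
    using Cons.prems by (intro bounded_clinear_comp bounded_clinear_q) simp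
  have "op_prod (b # bs) x = p (op_prod (b # bs) x) + (q \<circ> b) (op_prod bs x)"
    by (simp add: q_def op_prod_Cons)
  also have "(q \<circ> b) (op_prod bs x) = compressed (b # bs) x +
      (\<Sum>k<length bs. cinner (op_prod (drop k bs) x) \<Omega> *\<^sub>C compressed (b # take k bs) \<Omega>)"
    using Cons.prems
    by (subst Cons.IH) (simp_all add: bounded_clinear_add[OF qb] bounded_clinear_sum[OF qb]
        bounded_clinear_scaleC[OF qb] compressed_Cons del: o_apply, simp_all)
  \<comment> \<open>The \<open>p\<close> part is the summand 0, and the summands of the induction
    hypothesis move up by one.\<close>
  also have "p (op_prod (b # bs) x) + \<dots> = compressed (b # bs) x + (\<Sum>k<length (b # bs).
      cinner (op_prod (drop k (b # bs)) x) \<Omega> *\<^sub>C compressed (take k (b # bs)) \<Omega>)"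
    by (simp add: sum.lessThan_Suc_shift p_def compressed_Nil del: sum.lessThan_Suc)
  finally show ?case .
qed

text \<open>Subtracting the two-sided compression from \<open>op_prod_expand\<close> leaves a sum of
  rank one operators, so \<open>has_trace_sum_rank_one\<close> gives the trace.\<close>

lemma
  assumes "bs \<noteq> []" and bs: "\<And>b. b \<in> set bs \<Longrightarrow> bounded_clinear b"
  defines "T \<equiv> \<lambda>x. op_prod bs x - op_prod (map (\<lambda>b. q \<circ> b \<circ> q) bs) x"
  shows finite_rank_compression_defect: "finite_rank T"
    and op_trace_compression_defect: "op_trace T =
      (\<Sum>k<length bs. cinner (op_prod (drop k bs) (compressed (take k bs) \<Omega>)) \<Omega>)"
proof -
  let ?f = "\<lambda>k x. cinner (op_prod (drop k bs) x) \<Omega>"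
  let ?u = "\<lambda>k. compressed (take k bs) \<Omega>"
  have lin: "bounded_clinear (compressed bs)"
    by (rule bounded_clinear_compressed[OF bs])
  \<comment> \<open>Since \<open>x - q x = p x\<close> is a multiple of \<open>\<Omega>\<close>,
    this difference is one more term of the sum, at \<open>k = length bs\<close>, where
    \<open>drop\<close> leaves the empty product.\<close>
  have last: "compressed bs x - compressed bs (q x) = ?f (length bs) x *\<^sub>C ?u (length bs)" for x
    unfolding bounded_clinear_diff[OF lin, symmetric]
    by (simp add: q_def p_def op_prod_Nil bounded_clinear_scaleC[OF lin])
  have T: "T = (\<lambda>x. \<Sum>k\<in>{..length bs}. ?f k x *\<^sub>C ?u k)"
  proof
    fix x
    have "T x = (\<Sum>k<length bs. ?f k x *\<^sub>C ?u k) + (compressed bs x - compressed bs (q x))"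
      unfolding T_def op_prod_compress[OF \<open>bs \<noteq> []\<close>]
      using op_prod_expand[of bs x, OF bs] by simp
    then show "T x = (\<Sum>k\<in>{..length bs}. ?f k x *\<^sub>C ?u k)"
      by (simp only: last lessThan_Suc_atMost[symmetric] sum.lessThan_Suc)
  qed
  have f: "bounded_clinear (?f k)" for k
    using bounded_clinear_comp[OF bounded_clinear_cinner_left bounded_clinear_op_prod[of "drop k bs"]]
      bs by (simp add: o_def in_set_dropD)
  show "finite_rank T"
    unfolding T by (rule finite_rank_sum_rank_one[OF _ f]) simp
  \<comment> \<open>The extra term contributes nothing to the trace: its vector lies in the range of
    \<open>q\<close>, hence is orthogonal to \<open>\<Omega>\<close>.\<close>
  obtain b cs where "bs = b # cs"
    using \<open>bs \<noteq> []\<close> by (cases bs) auto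
  then have "cinner (compressed bs \<Omega>) \<Omega> = 0"
    by (simp add: compressed_Cons cinner_q_unit)
  moreover have "op_trace T = (\<Sum>k\<in>{..length bs}. ?f k (?u k))"
    unfolding T by (rule op_trace_eq[OF has_trace_sum_rank_one[OF f]])
  ultimately show "op_trace T = (\<Sum>k<length bs. ?f k (?u k))"
    by (simp add: op_prod_Nil flip: lessThan_Suc_atMost)
qed

text \<open>For nonempty \<open>bs\<close> this is
  \<open><b1 q b2 q ... q bn \<Omega>, \<Omega>>\<close>, the Boolean cumulant in operator form. A
  \<open>q\<close> before the first factor would make it 0.\<close>

definition compressed_moment :: "('h \<Rightarrow> 'h) list \<Rightarrow> complex"
  where "compressed_moment bs = cinner (hd bs (compressed (tl bs) \<Omega>)) \<Omega>"

text \<open>Expanding only \<open>tl bs\<close> keeps the place in front of the first factor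
  unsplit, so cut positions start at 1. The vector \<open>x\<close> is arbitrary because in the
  cyclic form it carries the wrapped-around part of the word.\<close>

lemma cinner_op_prod_expand:
  assumes "bs \<noteq> []" and bs: "\<And>b. b \<in> set bs \<Longrightarrow> bounded_clinear b"
  shows "cinner (op_prod bs x) \<Omega> = cinner (hd bs (compressed (tl bs) x)) \<Omega> +
    (\<Sum>k = 1..<length bs. compressed_moment (take k bs) * cinner (op_prod (drop k bs) x) \<Omega>)"
proof -
  obtain b cs where b: "bs = b # cs"
    using assms(1) by (cases bs) auto
  have lin: "bounded_clinear b" and cs: "\<And>c. c \<in> set cs \<Longrightarrow> bounded_clinear c"
    using bs by (auto simp: b)
  have "op_prod bs x = b (compressed cs x +
      (\<Sum>k<length cs. cinner (op_prod (drop k cs) x) \<Omega> *\<^sub>C compressed (take k cs) \<Omega>))"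
    using op_prod_expand[OF cs] by (simp add: b op_prod_Cons)
  also have "\<dots> = b (compressed cs x) +
      (\<Sum>k<length cs. cinner (op_prod (drop k cs) x) \<Omega> *\<^sub>C b (compressed (take k cs) \<Omega>))"
    by (simp add: bounded_clinear_add[OF lin] bounded_clinear_sum[OF lin]
        bounded_clinear_scaleC[OF lin])
  finally have "cinner (op_prod bs x) \<Omega> = cinner (b (compressed cs x)) \<Omega> +
      (\<Sum>k<length cs. compressed_moment (take (Suc k) bs) *
        cinner (op_prod (drop (Suc k) bs) x) \<Omega>)"
    by (simp add: cinner_add_left cinner_sum_left cinner_scaleC_left compressed_moment_def b
        mult.commute)
  also have "(\<Sum>k<length cs. compressed_moment (take (Suc k) bs) *
        cinner (op_prod (drop (Suc k) bs) x) \<Omega>) =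
      (\<Sum>k = 1..<length bs. compressed_moment (take k bs) * cinner (op_prod (drop k bs) x) \<Omega>)"
    unfolding b
    by (simp only: list.size One_nat_def sum.shift_bounds_Suc_ivl lessThan_atLeast0 add_0_right
        add_Suc_right)
  finally show ?thesis
    by (simp add: b)
qed

text \<open>For \<open>x = \<Omega>\<close> the uncut term becomes the term
  \<open>k = length bs\<close>, which yields the recursion required by
  \<open>boolean_cumulant_unique\<close>.\<close>

lemma cinner_op_prod_unit_expand:
  assumes "bs \<noteq> []" and "\<And>b. b \<in> set bs \<Longrightarrow> bounded_clinear b"
  shows "cinner (op_prod bs \<Omega>) \<Omega> =
    (\<Sum>k = 1..length bs. compressed_moment (take k bs) * cinner (op_prod (drop k bs) \<Omega>) \<Omega>)"
proof -
  have "{1..length bs} = insert (length bs) {1..<length bs}"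
    using assms(1) by (auto simp: Suc_le_eq)
  then show ?thesis
    using cinner_op_prod_expand[OF assms, of \<Omega>]
    by (simp add: compressed_moment_def op_prod_Nil cinner_unit)
qed

text \<open>With \<open>x\<close> the vector of the compressed prefix \<open>take m as\<close>,
  \<open>cinner_op_prod_expand\<close> is the same recursion in \<open>i\<close> as
  \<open>sum_cut_prod_rec\<close>, the cut \<open>j\<close> corresponding to
  \<open>k = j - i\<close>. The induction is on the number of letters from \<open>i\<close>
  on.\<close>

lemma sum_cut_prod_eq:
  assumes g: "\<And>bs. \<lbrakk>bs \<noteq> []; set bs \<subseteq> set as\<rbrakk> \<Longrightarrow> g bs = compressed_moment (map \<pi> bs)"
    and \<pi>: "\<And>a. a \<in> set as \<Longrightarrow> bounded_clinear (\<pi> a)"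
    and "i < length as"
  shows "(\<Sum>js\<in>cuts_from (length as) i. cut_prod g as m js) =
    cinner (op_prod (map \<pi> (drop i as)) (compressed (map \<pi> (take m as)) \<Omega>)) \<Omega>"
  using assms(3)
proof (induction "length as - i" arbitrary: i rule: less_induct)
  case less
  let ?x = "compressed (map \<pi> (take m as)) \<Omega>"
  let ?bs = "map \<pi> (drop i as)"
  let ?h = "\<lambda>k. compressed_moment (take k ?bs) * cinner (op_prod (drop k ?bs) ?x) \<Omega>"
  have ne: "drop i as \<noteq> []"
    using less.prems by simp
  have "g (drop i as @ take m as) = compressed_moment (map \<pi> (drop i as @ take m as))"
    using ne by (intro g) (auto dest: in_set_dropD in_set_takeD)
  \<comment> \<open>By \<open>compressed_append\<close>, the end of the word and the wrapped-around
    prefix act as one compressed word.\<close>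
  also have "\<dots> = cinner (hd ?bs (compressed (tl ?bs) ?x)) \<Omega>"
    using ne by (simp add: compressed_moment_def hd_map map_tl compressed_append)
  finally have last: "g (drop i as @ take m as) = \<dots>" .
  have "g (take (j - i) (drop i as)) * (\<Sum>js\<in>cuts_from (length as) j. cut_prod g as m js) =
      ?h (j - i)" if j: "j \<in> {i<..<length as}" for j
  proof -
    have "g (take (j - i) (drop i as)) = compressed_moment (take (j - i) ?bs)"
      unfolding take_map using j less.prems
      by (intro g) (auto dest: in_set_dropD in_set_takeD)
    moreover have "(\<Sum>js\<in>cuts_from (length as) j. cut_prod g as m js) =
        cinner (op_prod (drop (j - i) ?bs) ?x) \<Omega>"
      using j less.prems by (subst less.hyps) (auto simp: drop_map)
    ultimately show ?thesis
      by simp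
  qed
  then have "(\<Sum>js\<in>cuts_from (length as) i. cut_prod g as m js) =
      cinner (hd ?bs (compressed (tl ?bs) ?x)) \<Omega> + (\<Sum>j\<in>{i<..<length as}. ?h (j - i))"
    unfolding sum_cut_prod_rec[OF less.prems] last by simp
  also have "(\<Sum>j\<in>{i<..<length as}. ?h (j - i)) = (\<Sum>k = 1..<length ?bs. ?h k)"
    by (rule sum.reindex_bij_witness[of _ "\<lambda>k. k + i" "\<lambda>j. j - i"]) auto
  also have "cinner (hd ?bs (compressed (tl ?bs) ?x)) \<Omega> + \<dots> = cinner (op_prod ?bs ?x) \<Omega>"
    using ne \<pi> by (intro cinner_op_prod_expand[symmetric]) (auto dest: in_set_dropD)
  finally show ?case .
qed

end

section \<open>Products inside the von Neumann algebra, and the theorem\<close>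

lemma id_in_commutant: "id \<in> commutant A"
  by (simp add: commutant_def bounded_clinear_id)

lemma comp_in_commutant:
  assumes "b \<in> commutant A" "c \<in> commutant A"
  shows "b \<circ> c \<in> commutant A"
proof -
  have "a \<circ> (b \<circ> c) = b \<circ> c \<circ> a" if "a \<in> A" for a
  proof -
    have "a \<circ> b = b \<circ> a" "a \<circ> c = c \<circ> a"
      using assms that by (auto simp: commutant_def)
    then show ?thesis
      by (metis comp_assoc)
  qed
  with assms show ?thesis
    by (auto simp: commutant_def intro: bounded_clinear_comp)
qed

text \<open>\<open>A\<close> is itself a commutant, that of \<open>commutant A\<close>, so it
  contains \<open>id\<close> and is closed under composition. This gives access to
  \<open>vector_state\<close> and \<open>rep_mult\<close>, which concern elements of
  \<open>A\<close>.\<close>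

lemma (in von_neumann_algebra) op_prod_in: "set as \<subseteq> A \<Longrightarrow> op_prod as \<in> A"
proof (induction as)
  case Nil
  show ?case
    using id_in_commutant[of "commutant A"] unfolding op_prod_Nil double_commutant .
next
  case (Cons a as)
  then have "a \<in> A" "op_prod as \<in> A"
    by simp_all
  then show ?case
    using comp_in_commutant[of a "commutant A" "op_prod as"]
    unfolding op_prod_Cons double_commutant by blast
qed

theorem proposition1p4:
  fixes A :: "('k::complex_hilbert_space \<Rightarrow> 'k) set"
    and \<phi> :: "('k \<Rightarrow> 'k) \<Rightarrow> complex"
    and \<pi> :: "('k \<Rightarrow> 'k) \<Rightarrow> ('h::complex_hilbert_space \<Rightarrow> 'h)"
    and \<Omega> :: 'h
    and p q :: "'h \<Rightarrow> 'h"
    and as :: "('k \<Rightarrow> 'k) list"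
  assumes "wstar_probability_space A \<phi>"
    and "gns_representation A \<phi> \<pi> \<Omega>"
    and "p = orth_proj (cspan {\<Omega>})"
    and "q = (\<lambda>x. x - p x)"
    and "as \<noteq> []"
    and "set as \<subseteq> A"
  shows "finite_rank (\<lambda>x. op_prod (map \<pi> as) x - op_prod (map (\<lambda>a. q \<circ> \<pi> a \<circ> q) as) x) \<and>
    op_trace (\<lambda>x. op_prod (map \<pi> as) x - op_prod (map (\<lambda>a. q \<circ> \<pi> a \<circ> q) as) x)
      = cyclic_form \<phi> as"
proof -
  interpret wstar_probability_space A \<phi>
    by fact
  interpret gns_representation A \<phi> \<pi> \<Omega>
    by fact
  have "id \<in> A"
    using op_prod_in[of "[]"] by (simp add: op_prod_Nil)
  then have "cinner \<Omega> \<Omega> = 1"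
    using vector_state[of id] unit rep_unit by simp
  then interpret v: unit_vector \<Omega>
    by unfold_locales
  have q: "q = v.q"
    using assms(3,4) by (simp add: fun_eq_iff v.q_def v.orth_proj_eq_p)
  have op_prod_\<pi>: "\<pi> (op_prod bs) = op_prod (map \<pi> bs)" if "set bs \<subseteq> A" for bs
    using that by (induction bs) (simp_all add: op_prod_Nil op_prod_Cons rep_unit rep_mult op_prod_in)
  have \<pi>_bounded: "bounded_clinear b" if "b \<in> set (map \<pi> bs)" "set bs \<subseteq> A" for b bs
    using that rep_bounded by auto
  have \<phi>_eq: "\<phi> (op_prod bs) = cinner (op_prod (map \<pi> bs) \<Omega>) \<Omega>" if "set bs \<subseteq> A" for bs
    using vector_state[OF op_prod_in[OF that]] op_prod_\<pi>[OF that] by simp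
  \<comment> \<open>Compressed moments obey the first-block recursion of the moments of
    \<open>\<phi>\<close>, so uniqueness identifies them with the cumulants.\<close>
  have cumulant: "boolean_cumulant \<phi> bs = v.compressed_moment (map \<pi> bs)"
    if "bs \<noteq> []" "set bs \<subseteq> A" for bs
    using unit _ that
  proof (rule boolean_cumulant_unique[where g = "\<lambda>bs. v.compressed_moment (map \<pi> bs)"])
    fix cs :: "('k \<Rightarrow> 'k) list" assume cs: "cs \<noteq> []" "set cs \<subseteq> A"
    have "set (drop k cs) \<subseteq> A" for k
      using order_trans[OF set_drop_subset cs(2)] .
    then show "\<phi> (op_prod cs) =
        (\<Sum>k = 1..length cs. v.compressed_moment (map \<pi> (take k cs)) * \<phi> (op_prod (drop k cs)))"
      using v.cinner_op_prod_unit_expand[of "map \<pi> cs"] cs \<pi>_bounded[of _ cs]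
      by (simp add: \<phi>_eq take_map drop_map)
  qed
  \<comment> \<open>Here \<open>sum_cut_prod_eq\<close> is used with \<open>i = m\<close>: the cuts
    start at \<open>m\<close>, and the last segment returns to the same \<open>m\<close>.\<close>
  have "cyclic_form \<phi> as = (\<Sum>m<length as.
      cinner (op_prod (map \<pi> (drop m as)) (v.compressed (map \<pi> (take m as)) \<Omega>)) \<Omega>)"
    unfolding cyclic_form_eq_sum_cuts[OF \<open>as \<noteq> []\<close>]
  proof (rule sum.cong[OF refl])
    fix m assume "m \<in> {..<length as}"
    then show "(\<Sum>js\<in>cuts_from (length as) m. cut_prod (boolean_cumulant \<phi>) as m js) =
        cinner (op_prod (map \<pi> (drop m as)) (v.compressed (map \<pi> (take m as)) \<Omega>)) \<Omega>"
      using \<open>set as \<subseteq> A\<close> cumulant rep_bounded by (intro v.sum_cut_prod_eq) auto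
  qed
  then show ?thesis
    using v.finite_rank_compression_defect[of "map \<pi> as"]
      v.op_trace_compression_defect[of "map \<pi> as"] \<open>as \<noteq> []\<close> \<pi>_bounded[OF _ \<open>set as \<subseteq> A\<close>]
    by (simp add: take_map drop_map q o_def)
qed

end
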